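(* For every integer $n\ge 4$, the fan graph $F_n=K_1\vee P_{n-1}$ and the wheel graph $W_n=K_1\vee C_{n-1}$ satisfy $$\gamma_{MR}(F_n)=\gamma_{MR}(W_n).$$
   Context: All graphs are finite and simple. For a vertex $v$ of $G=(V,E)$, $N[v]=\{v\}\cup\{u: uv\in E\}$ is the closed neighborhood, and for $f:V\to\mathbb{R}$ and $S\subseteq V$, $f(S)=\sum_{x\in S}f(x)$. A majority Roman dominating function (MRDF) on $G$ is a function $f:V\to\{-1,1,2\}$ such that (i) $f(N[v])\ge 1$ for at least half of the vertices $v\in V$, and (ii) every vertex $u$ with $f(u)=-1$ is adjacent to at least one vertex $w$ with $f(w)=2$. The weight of $f$ is $f(V)$, and the majority Roman domination number $\gamma_{MR}(G)$ is the minimum weight of an MRDF on $G$. The join $G\vee H$ of disjoint graphs has vertex set $V(G)\cup V(H)$ and edge set $E(G)\cup E(H)\cup\{xy: x\in V(G), y\in V(H)\}$. $P_{n-1}$ and $C_{n-1}$ are the path and the cycle on $n-1$ vertices. It is known from earlier literature that $\gamma_{MR}(W_n)=2\lceil n/6\rceil-n+3$ for $n\ge 4$. *)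

theory Defs
  imports Main
begin

section \<open>Finite simple graphs\<close>

text \<open>Edges are two-element sets of vertices.\<close>

record 'a graph =
  verts :: "'a set"
  edges :: "'a set set"

definition simple_graph :: "'a graph \<Rightarrow> bool" where
  "simple_graph G \<longleftrightarrow>
     finite (verts G) \<and> (\<forall>e\<in>edges G. e \<subseteq> verts G \<and> card e = 2)"

definition closed_nbhd :: "'a graph \<Rightarrow> 'a \<Rightarrow> 'a set" where
  "closed_nbhd G v = {v} \<union> {u. {u, v} \<in> edges G}"

definition complete_graph :: "nat \<Rightarrow> nat graph" where
  "complete_graph m =
     \<lparr>verts = {..<m}, edges = {{i, j} | i j. i < m \<and> j < m \<and> i \<noteq> j}\<rparr>"

definition path_graph :: "nat \<Rightarrow> nat graph" where
  "path_graph m = \<lparr>verts = {..<m}, edges = {{i, Suc i} | i. Suc i < m}\<rparr>"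

text \<open>The definition below gives the cycle only for \<open>m \<ge> 3\<close>; for \<open>m = 1\<close> it would
  contain a singleton edge, and for \<open>m = 2\<close> it collapses to a single edge.\<close>

definition cycle_graph :: "nat \<Rightarrow> nat graph" where
  "cycle_graph m = \<lparr>verts = {..<m}, edges = {{i, Suc i mod m} | i. i < m}\<rparr>"

text \<open>The sum type makes the two vertex sets disjoint.\<close>

definition graph_join :: "'a graph \<Rightarrow> 'b graph \<Rightarrow> ('a + 'b) graph" where
  "graph_join G H =
     \<lparr>verts = Inl ` verts G \<union> Inr ` verts H,
      edges = image Inl ` edges G \<union> image Inr ` edges H
                \<union> {{Inl x, Inr y} | x y. x \<in> verts G \<and> y \<in> verts H}\<rparr>"

definition fan_graph :: "nat \<Rightarrow> (nat + nat) graph" where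
  "fan_graph n = graph_join (complete_graph 1) (path_graph (n - 1))"

definition wheel_graph :: "nat \<Rightarrow> (nat + nat) graph" where
  "wheel_graph n = graph_join (complete_graph 1) (cycle_graph (n - 1))"


section \<open>Majority Roman domination\<close>

text \<open>Functions are total on the vertex type; only their values on \<open>verts G\<close> matter.\<close>

definition MRDF :: "'a graph \<Rightarrow> ('a \<Rightarrow> int) \<Rightarrow> bool" where
  "MRDF G f \<longleftrightarrow>
     (\<forall>v\<in>verts G. f v \<in> {-1, 1, 2}) \<and>
     card (verts G) \<le> 2 * card {v \<in> verts G. sum f (closed_nbhd G v) \<ge> 1} \<and>
     (\<forall>u\<in>verts G. f u = -1 \<longrightarrow> (\<exists>w\<in>verts G. {u, w} \<in> edges G \<and> f w = 2))"

definition gamma_MR :: "'a graph \<Rightarrow> int" where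
  "gamma_MR G = Min {sum f (verts G) | f. MRDF G f}"


section \<open>Well-definedness\<close>

lemma simple_complete_graph: "simple_graph (complete_graph m)"
  by (auto simp: simple_graph_def complete_graph_def)

lemma simple_path_graph: "simple_graph (path_graph m)"
  by (auto simp: simple_graph_def path_graph_def)

lemma simple_cycle_graph:
  assumes "m \<ge> 3"
  shows "simple_graph (cycle_graph m)"
proof -
  have "i \<noteq> Suc i mod m" if "i < m" for i
    using that assms by (cases "Suc i = m") auto
  then show ?thesis
    using assms by (auto simp: simple_graph_def cycle_graph_def)
qed

lemma simple_graph_join:
  assumes "simple_graph G" "simple_graph H"
  shows "simple_graph (graph_join G H)"
  using assms by (fastforce simp: simple_graph_def graph_join_def card_image)

lemma simple_fan_graph: "simple_graph (fan_graph n)"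
  by (simp add: fan_graph_def simple_graph_join simple_complete_graph simple_path_graph)

lemma simple_wheel_graph: "n \<ge> 4 \<Longrightarrow> simple_graph (wheel_graph n)"
  by (simp add: wheel_graph_def simple_graph_join simple_complete_graph simple_cycle_graph)

lemma card_verts_fan_graph: "n \<ge> 1 \<Longrightarrow> card (verts (fan_graph n)) = n"
  by (auto simp: fan_graph_def graph_join_def complete_graph_def path_graph_def card_image
      intro!: card_Un_disjoint[THEN trans])

lemma card_verts_wheel_graph: "n \<ge> 1 \<Longrightarrow> card (verts (wheel_graph n)) = n"
  by (auto simp: wheel_graph_def graph_join_def complete_graph_def cycle_graph_def card_image
      intro!: card_Un_disjoint[THEN trans])

lemma finite_closed_nbhd:
  assumes "simple_graph G"
  shows "finite (closed_nbhd G v)"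
proof -
  have "{u. {u, v} \<in> edges G} \<subseteq> verts G"
    using assms by (auto simp: simple_graph_def)
  then show ?thesis
    using assms by (auto simp: closed_nbhd_def simple_graph_def intro: finite_subset)
qed

lemma finite_MRDF_weights:
  assumes "simple_graph G"
  shows "finite {sum f (verts G) | f. MRDF G f}"
proof (rule finite_subset)
  let ?n = "int (card (verts G))"
  show "{sum f (verts G) | f. MRDF G f} \<subseteq> {- ?n..2 * ?n}"
  proof clarify
    fix f assume "MRDF G f"
    then have "-1 \<le> f v \<and> f v \<le> 2" if "v \<in> verts G" for v
      using that by (force simp: MRDF_def)
    then show "sum f (verts G) \<in> {- ?n..2 * ?n}"
      using sum_bounded_below[of "verts G" "-1" f] sum_bounded_above[of "verts G" f 2]
      by (simp add: mult.commute)
  qed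
qed simp

lemma MRDF_const_1:
  assumes "simple_graph G"
  shows "MRDF G (\<lambda>_. 1)"
proof -
  have "(\<Sum>u\<in>closed_nbhd G v. 1 :: int) \<ge> 1" for v
  proof -
    have "card (closed_nbhd G v) > 0"
      using finite_closed_nbhd[OF assms] by (auto simp: card_gt_0_iff closed_nbhd_def)
    then show ?thesis by simp
  qed
  then show ?thesis by (simp add: MRDF_def)
qed

lemma gamma_MR_attained:
  assumes "simple_graph G"
  shows "\<exists>f. MRDF G f \<and> sum f (verts G) = gamma_MR G"
proof -
  have "{sum f (verts G) | f. MRDF G f} \<noteq> {}"
    using MRDF_const_1[OF assms] by blast
  from Min_in[OF finite_MRDF_weights[OF assms] this] show ?thesis
    by (force simp: gamma_MR_def)
qed

lemma gamma_MR_le: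
  assumes "simple_graph G" "MRDF G f"
  shows "gamma_MR G \<le> sum f (verts G)"
  unfolding gamma_MR_def using finite_MRDF_weights[OF assms(1)] assms(2)
  by (intro Min_le) auto

end

theory Submission
  imports Defs
begin

text \<open>Both graphs are joins \<open>K\<^sub>1 \<or> H\<close> where every vertex of \<open>H\<close> has degree one or two and \<open>H\<close> contains
  a Hamiltonian path. For all such joins \<open>\<gamma>\<^sub>M\<^sub>R = 2 \<lceil>n/6\<rceil> - n + 3\<close>. If the hub has value 2, a vertex of \<open>H\<close>
  is satisfied exactly when its closed neighbourhood in \<open>H\<close> has a positive vertex, so \<open>k\<close> positive
  vertices satisfy at most \<open>3 k\<close> vertices; placing them at distance 3 on the path attains this. If the
  hub has another value, every vertex of value \<open>-1\<close> in \<open>H\<close> has a neighbour of value 2 in \<open>H\<close>, and each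
  of those serves at most two vertices. Hence \<open>H\<close> has nonnegative weight, and double counting
  shows that weight 0 leaves every vertex unsatisfied when the hub is \<open>-1\<close>.\<close>

section \<open>Functions with values in \<open>{-1, 1, 2}\<close>\<close>

text \<open>Turns weights into linear arithmetic in three cardinalities; applied both to all of
  \<open>H\<close> and to a single open neighbourhood.\<close>

lemma sum_by_values:
  fixes g :: "'a \<Rightarrow> int"
  assumes "finite S" "\<forall>v\<in>S. g v \<in> {-1, 1, 2}"
  shows "sum g S = 2 * int (card {v \<in> S. g v = 2}) + int (card {v \<in> S. g v = 1})
           - int (card {v \<in> S. g v = -1})"
    and "card S = card {v \<in> S. g v = 2} + card {v \<in> S. g v = 1} + card {v \<in> S. g v = -1}"
proof -
  let ?T = "\<lambda>c. {v \<in> S. g v = c}"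
  have split: "S = ?T 2 \<union> (?T 1 \<union> ?T (-1))"
    using assms(2) by auto
  have fin: "finite (?T c)" for c
    using assms(1) by simp
  have disj: "?T 2 \<inter> (?T 1 \<union> ?T (-1)) = {}" "?T 1 \<inter> ?T (-1) = {}"
    by auto
  have "sum g S = sum g (?T 2 \<union> (?T 1 \<union> ?T (-1)))"
    using split by (rule arg_cong)
  also have "\<dots> = sum g (?T 2) + (sum g (?T 1) + sum g (?T (-1)))"
    by (simp only: sum.union_disjoint fin finite_UnI disj)
  finally show "sum g S = 2 * int (card (?T 2)) + int (card (?T 1)) - int (card (?T (-1)))"
    by simp
  have "card S = card (?T 2 \<union> (?T 1 \<union> ?T (-1)))"
    using split by (rule arg_cong)
  also have "\<dots> = card (?T 2) + (card (?T 1) + card (?T (-1)))"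
    by (simp only: card_Un_disjoint fin finite_UnI disj)
  finally show "card S = card (?T 2) + card (?T 1) + card (?T (-1))"
    by simp
qed

section \<open>Neighbourhoods\<close>

lemma closed_nbhd_subset:
  assumes "simple_graph G" "v \<in> verts G"
  shows "closed_nbhd G v \<subseteq> verts G"
  using assms by (auto simp: simple_graph_def closed_nbhd_def)

lemma closed_nbhd_sym: "u \<in> closed_nbhd G v \<longleftrightarrow> v \<in> closed_nbhd G u"
  by (auto simp: closed_nbhd_def insert_commute)

lemma closed_nbhd_insert:
  assumes "simple_graph G"
  shows "closed_nbhd G v = insert v {u. {u, v} \<in> edges G}"
    and "v \<notin> {u. {u, v} \<in> edges G}"
    and "finite {u. {u, v} \<in> edges G}"
proof -
  show "closed_nbhd G v = insert v {u. {u, v} \<in> edges G}"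
    by (auto simp: closed_nbhd_def)
  then show "finite {u. {u, v} \<in> edges G}"
    using finite_closed_nbhd[OF assms, of v] by simp
  show "v \<notin> {u. {u, v} \<in> edges G}"
    using assms by (auto simp: simple_graph_def)
qed

section \<open>Cones\<close>

text \<open>The hub is \<open>Inl 0\<close>. Fans and wheels are the cones over paths and cycles,
  directly by unfolding.\<close>

definition cone :: "'a graph \<Rightarrow> (nat + 'a) graph" where
  "cone H = graph_join (complete_graph 1) H"

lemma verts_cone: "verts (cone H) = insert (Inl 0) (Inr ` verts H)"
  by (auto simp: cone_def graph_join_def complete_graph_def)

lemma edges_cone:
  "edges (cone H) = image Inr ` edges H \<union> (\<lambda>v. {Inl 0, Inr v}) ` verts H"
  by (auto simp: cone_def graph_join_def complete_graph_def)

lemma edge_cone_Inr: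
  fixes u v :: 'a
  shows "{Inr u, Inr v} \<in> edges (cone H) \<longleftrightarrow> {u, v} \<in> edges H"
proof -
  have "(Inr ` {u, v} :: (nat + 'a) set) \<in> image Inr ` edges H \<longleftrightarrow> {u, v} \<in> edges H"
    by (simp only: image_iff inj_image_eq_iff[OF inj_Inr]) simp
  moreover have "{Inr u, Inr v :: nat + 'a} \<notin> (\<lambda>v. {Inl 0, Inr v}) ` verts H"
    by (auto simp: doubleton_eq_iff)
  ultimately show ?thesis
    by (simp add: edges_cone)
qed

lemma edge_cone_Inl: "{Inl i, Inr v} \<in> edges (cone H) \<longleftrightarrow> i = 0 \<and> v \<in> verts H"
  by (auto simp: edges_cone doubleton_eq_iff)

lemma edge_cone_Inl_Inl:
  assumes "simple_graph H"
  shows "{Inl i, Inl j} \<notin> edges (cone H)"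
proof
  assume "{Inl i, Inl j} \<in> edges (cone H)"
  then obtain e where e: "e \<in> edges H" "{Inl i, Inl j} = Inr ` e"
    by (auto simp: edges_cone doubleton_eq_iff)
  then have "e = {}" by blast
  then show False
    using e(1) assms by (auto simp: simple_graph_def)
qed

lemma closed_nbhd_cone_hub:
  assumes "simple_graph H"
  shows "closed_nbhd (cone H) (Inl 0) = verts (cone H)"
proof -
  have "u \<in> closed_nbhd (cone H) (Inl 0) \<longleftrightarrow> u \<in> verts (cone H)" for u
    using edge_cone_Inl_Inl[OF assms] edge_cone_Inl[of 0 _ H]
    by (cases u) (auto simp: closed_nbhd_def verts_cone insert_commute)
  then show ?thesis by auto
qed

lemma closed_nbhd_cone_Inr:
  assumes "v \<in> verts H"
  shows "closed_nbhd (cone H) (Inr v) = insert (Inl 0) (Inr ` closed_nbhd H v)"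
proof -
  have "u \<in> closed_nbhd (cone H) (Inr v) \<longleftrightarrow> u \<in> insert (Inl 0) (Inr ` closed_nbhd H v)" for u
    using assms by (cases u) (auto simp: closed_nbhd_def edge_cone_Inl edge_cone_Inr)
  then show ?thesis by blast
qed

lemma simple_cone: "simple_graph H \<Longrightarrow> simple_graph (cone H)"
  by (simp add: cone_def simple_graph_join simple_complete_graph)

lemma sum_insert_Inl:
  assumes "finite S"
  shows "sum f (insert (Inl i) (Inr ` S)) = f (Inl i) + (\<Sum>v\<in>S. f (Inr v))"
  using assms by (subst sum.insert) (auto simp: sum.reindex o_def)

text \<open>The hub sees every vertex, so it is satisfied exactly when the total weight is positive.
  A rim vertex sees the hub and its closed neighbourhood in \<open>H\<close>. This moves the problem
  into \<open>H\<close>, with the hub value as a parameter.\<close>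

lemma MRDF_cone_iff:
  assumes "simple_graph H"
  defines "V \<equiv> verts H"
  shows "MRDF (cone H) f \<longleftrightarrow>
    f (Inl 0) \<in> {-1, 1, 2} \<and> (\<forall>v\<in>V. f (Inr v) \<in> {-1, 1, 2}) \<and>
    card V + 1 \<le> 2 * ((if f (Inl 0) + (\<Sum>v\<in>V. f (Inr v)) \<ge> 1 then 1 else 0)
      + card {v \<in> V. f (Inl 0) + (\<Sum>u\<in>closed_nbhd H v. f (Inr u)) \<ge> 1}) \<and>
    (f (Inl 0) = -1 \<longrightarrow> (\<exists>w\<in>V. f (Inr w) = 2)) \<and>
    (\<forall>u\<in>V. f (Inr u) = -1 \<longrightarrow> f (Inl 0) = 2 \<or> (\<exists>w\<in>V. {u, w} \<in> edges H \<and> f (Inr w) = 2))"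
proof -
  have fin: "finite V"
    using assms by (simp add: simple_graph_def)
  have card: "card (verts (cone H)) = card V + 1"
    using fin by (simp add: verts_cone V_def card_image image_iff)
  have hub: "sum f (closed_nbhd (cone H) (Inl 0)) = f (Inl 0) + (\<Sum>v\<in>V. f (Inr v))"
    using fin by (simp add: closed_nbhd_cone_hub assms verts_cone sum_insert_Inl)
  have rim: "sum f (closed_nbhd (cone H) (Inr v))
      = f (Inl 0) + (\<Sum>u\<in>closed_nbhd H v. f (Inr u))" if "v \<in> V" for v
    using that assms finite_closed_nbhd[OF assms(1)]
    by (simp add: closed_nbhd_cone_Inr sum_insert_Inl)
  have "{x \<in> verts (cone H). sum f (closed_nbhd (cone H) x) \<ge> 1}
     = (if f (Inl 0) + (\<Sum>v\<in>V. f (Inr v)) \<ge> 1 then {Inl 0} else {})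
       \<union> Inr ` {v \<in> V. f (Inl 0) + (\<Sum>u\<in>closed_nbhd H v. f (Inr u)) \<ge> 1}"
    using hub rim by (auto simp: verts_cone V_def)
  then have good: "card {x \<in> verts (cone H). sum f (closed_nbhd (cone H) x) \<ge> 1}
     = (if f (Inl 0) + (\<Sum>v\<in>V. f (Inr v)) \<ge> 1 then 1 else 0)
       + card {v \<in> V. f (Inl 0) + (\<Sum>u\<in>closed_nbhd H v. f (Inr u)) \<ge> 1}"
    using fin by (simp add: card_image image_iff)
  have hub_adj: "(\<exists>w\<in>verts (cone H). {Inl 0, w} \<in> edges (cone H) \<and> f w = 2)
      \<longleftrightarrow> (\<exists>w\<in>V. f (Inr w) = 2)"
    using edge_cone_Inl_Inl[OF assms(1), of 0 0]
    by (auto simp: verts_cone edge_cone_Inl V_def)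
  have rim_adj: "(\<exists>w\<in>verts (cone H). {Inr u, w} \<in> edges (cone H) \<and> f w = 2)
      \<longleftrightarrow> f (Inl 0) = 2 \<or> (\<exists>w\<in>V. {u, w} \<in> edges H \<and> f (Inr w) = 2)" if "u \<in> V" for u
    using that edge_cone_Inl[of 0 u H]
    by (auto simp: verts_cone edge_cone_Inr V_def insert_commute)
  show ?thesis
    unfolding MRDF_def card good using hub_adj rim_adj
    by (auto simp: verts_cone V_def)
qed

section \<open>Lower bound\<close>

text \<open>Count the edges between values 2 and -1: at least one at each -1, at most two at each 2.
  Weight at most 0 would make both estimates tight and exclude the value 1, so closed neighbourhoods
  would be too light.\<close>

lemma roman_weight_nonneg:
  fixes g :: "'a \<Rightarrow> int"
  assumes H: "simple_graph H"
    and deg: "\<forall>v\<in>verts H. card (closed_nbhd H v) \<le> 3"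
    and vals: "\<forall>v\<in>verts H. g v \<in> {-1, 1, 2}"
    and roman: "\<forall>u\<in>verts H. g u = -1 \<longrightarrow> (\<exists>w\<in>verts H. {u, w} \<in> edges H \<and> g w = 2)"
  shows "card {v \<in> verts H. g v = -1} \<le> 2 * card {v \<in> verts H. g v = 2}"
    and "v \<in> verts H \<Longrightarrow> sum g (closed_nbhd H v) \<ge> 2 \<Longrightarrow> sum g (verts H) \<ge> 1"
proof -
  define V where "V = verts H"
  define A where "A = {v \<in> V. g v = 2}"
  define B where "B = {v \<in> V. g v = -1}"
  define N where "N = (\<lambda>v. {u. {u, v} \<in> edges H})"
  have fin: "finite V" "finite A" "finite B"
    using H by (auto simp: simple_graph_def V_def A_def B_def)
  have N: "finite (N v)" "v \<notin> N v" "closed_nbhd H v = insert v (N v)" for v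
    using closed_nbhd_insert[OF H, of v] by (auto simp: N_def)
  have NV: "N v \<subseteq> V" if "v \<in> V" for v
    using that closed_nbhd_subset[OF H, of v] N(3) by (auto simp: V_def)
  have cardN: "card (N v) \<le> 2" if "v \<in> V" for v
    using that deg N[of v] by (fastforce simp: V_def)
  define d where "d = (\<lambda>u. card {w \<in> N u. g w = 2})"
  define e where "e = (\<lambda>w. card {u \<in> N w. g u = -1})"
  have d1: "1 \<le> d u" if "u \<in> B" for u
  proof -
    obtain w where "{u, w} \<in> edges H" "g w = 2"
      using \<open>u \<in> B\<close> roman by (auto simp: B_def V_def)
    then have "{w \<in> N u. g w = 2} \<noteq> {}"
      using insert_commute[of u w "{}"] by (auto simp: N_def)
    then show ?thesis
      using N(1)[of u] by (simp add: d_def card_gt_0_iff Suc_le_eq)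
  qed
  have e2: "e w \<le> 2" if "w \<in> A" for w
  proof -
    have "e w \<le> card (N w)"
      unfolding e_def by (intro card_mono N) auto
    then show ?thesis
      using cardN[of w] that by (auto simp: A_def)
  qed
  have double: "sum d B = sum e A"
  proof -
    have dA: "d u = card {w \<in> A. {u, w} \<in> edges H}" if "u \<in> B" for u
      unfolding d_def using NV[of u] that
      by (intro arg_cong[of _ _ card]) (auto simp: A_def B_def N_def insert_commute)
    have eB: "e w = card {u \<in> B. {u, w} \<in> edges H}" if "w \<in> A" for w
      unfolding e_def using NV[of w] that
      by (intro arg_cong[of _ _ card]) (auto simp: A_def B_def N_def insert_commute)
    show ?thesis
      using sum_multicount_gen[OF fin(3,2), of "\<lambda>u w. {u, w} \<in> edges H" e] dA eB by simp
  qed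
  have lo: "card B \<le> sum d B"
    using sum_mono[of B "\<lambda>_. 1" d] d1 by simp
  have hi: "sum e A \<le> 2 * card A"
    using sum_mono[of A e "\<lambda>_. 2"] e2 by simp
  show BA: "card {v \<in> verts H. g v = -1} \<le> 2 * card {v \<in> verts H. g v = 2}"
    using lo hi double by (simp add: A_def B_def V_def)
  assume v: "v \<in> verts H" and good: "sum g (closed_nbhd H v) \<ge> 2"
  note total = sum_by_values[of V g, OF fin(1), folded A_def B_def]
  have valsN: "\<forall>u\<in>N v. g u \<in> {-1, 1, 2}"
    using NV[of v] v vals by (auto simp: V_def)
  note local = sum_by_values[OF N(1) valsN]
  have closed: "sum g (closed_nbhd H v) = g v + sum g (N v)"
    using N[of v] by simp
  show "sum g (verts H) \<ge> 1"
  proof (rule ccontr)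
    assume "\<not> ?thesis"
    then have small: "sum g V \<le> 0"
      by (simp add: V_def)
    \<comment> \<open>The weight is \<open>2 * card A\<close> plus the number of ones minus
      \<open>card B\<close>, and \<open>card B \<le> 2 * card A\<close>.\<close>
    have tight: "card B = 2 * card A" and noC: "card {v \<in> V. g v = 1} = 0"
      using total vals lo hi double small by (auto simp: V_def)
    have noC': "{u \<in> V. g u = 1} = {}"
      using noC fin by simp
    then have no1: "{u \<in> N v. g u = 1} = {}"
      using NV[of v] v by (auto simp: V_def)
    have "v \<in> A \<or> v \<in> B"
      using v vals noC' by (auto simp: A_def B_def V_def)
    then show False
    proof
      assume "v \<in> B"
      have "d v \<le> 1"
      proof (rule ccontr)
        assume "\<not> d v \<le> 1"
        then have "sum (\<lambda>_. 1) B < sum d B"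
          using \<open>v \<in> B\<close> d1 fin by (intro sum_strict_mono_ex1 bexI[of _ v]) auto
        then show False
          using tight hi double by simp
      qed
      \<comment> \<open>One neighbour of value 2 at most: the closed sum is at most -1 + 2 =
        1.\<close>
      then show False
        using good closed local no1 \<open>v \<in> B\<close> by (simp add: d_def B_def)
    next
      assume "v \<in> A"
      have "e v \<ge> 2"
      proof (rule ccontr)
        assume "\<not> e v \<ge> 2"
        then have "sum e A < sum (\<lambda>_. 2) A"
          using \<open>v \<in> A\<close> e2 fin by (intro sum_strict_mono_ex1 bexI[of _ v]) auto
        then show False
          using tight lo double by simp
      qed
      \<comment> \<open>The two neighbours of value -1 are all the neighbours: the closed sum is 2 -
        2 = 0.\<close>
      then show False
        using good closed local no1 \<open>v \<in> A\<close> cardN[of v] by (simp add: e_def A_def)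
    qed
  qed
qed

text \<open>With hub value 2, a satisfied rim vertex has a positive vertex in its closed
  neighbourhood, and each positive vertex covers at most three vertices.\<close>

lemma dominated_count:
  fixes g :: "'a \<Rightarrow> int"
  assumes H: "simple_graph H"
    and deg: "\<forall>v\<in>verts H. card (closed_nbhd H v) \<in> {2, 3}"
    and vals: "\<forall>v\<in>verts H. g v \<in> {-1, 1, 2}"
  shows "card {v \<in> verts H. 2 + sum g (closed_nbhd H v) \<ge> 1} \<le> 3 * card {v \<in> verts H. g v > 0}"
proof -
  let ?P = "{v \<in> verts H. g v > 0}"
  have fin: "finite ?P"
    using H by (simp add: simple_graph_def)
  have "{v \<in> verts H. 2 + sum g (closed_nbhd H v) \<ge> 1} \<subseteq> (\<Union>p\<in>?P. closed_nbhd H p)"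
  proof clarify
    fix v assume v: "v \<in> verts H" and good: "2 + sum g (closed_nbhd H v) \<ge> 1"
    have "\<exists>p\<in>closed_nbhd H v. g p > 0"
    proof (rule ccontr)
      assume none: "\<not> ?thesis"
      have "g p = -1" if "p \<in> closed_nbhd H v" for p
        using that none vals closed_nbhd_subset[OF H v] by fastforce
      then have "sum g (closed_nbhd H v) = - int (card (closed_nbhd H v))"
        by simp
      \<comment> \<open>At least two members of value -1 push the sum to -2 or below; an isolated
        vertex would escape this.\<close>
      then show False
        using good deg v by fastforce
    qed
    then show "v \<in> (\<Union>p\<in>?P. closed_nbhd H p)"
      using closed_nbhd_subset[OF H v] closed_nbhd_sym[of _ H v] by auto
  qed
  then have "card {v \<in> verts H. 2 + sum g (closed_nbhd H v) \<ge> 1}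
      \<le> card (\<Union>p\<in>?P. closed_nbhd H p)"
    using fin finite_closed_nbhd[OF H] by (intro card_mono) auto
  also have "\<dots> \<le> (\<Sum>p\<in>?P. card (closed_nbhd H p))"
    by (rule card_UN_le[OF fin])
  also have "\<dots> \<le> (\<Sum>p\<in>?P. 3)"
    using deg by (intro sum_mono) auto
  finally show ?thesis by simp
qed

lemma MRDF_cone_weight_ge:
  assumes H: "simple_graph H"
    and deg: "\<forall>v\<in>verts H. card (closed_nbhd H v) \<in> {2, 3}"
    and n: "card (verts H) + 1 = n" "n \<ge> 4"
    and f: "MRDF (cone H) f"
  shows "2 * int ((n + 5) div 6) - int n + 3 \<le> sum f (verts (cone H))"
proof -
  define V where "V = verts H"
  define g where "g = (\<lambda>v. f (Inr v))"
  define h where "h = f (Inl 0)"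
  have fin: "finite V"
    using H by (simp add: simple_graph_def V_def)
  have weight: "sum f (verts (cone H)) = h + sum g V"
    using fin by (simp add: verts_cone sum_insert_Inl g_def h_def V_def)
  note F = f[unfolded MRDF_cone_iff[OF H], folded V_def h_def g_def]
  have g_eq: "(\<Sum>v\<in>S. f (Inr v)) = sum g S" for S
    by (simp add: g_def)
  have vals: "\<forall>v\<in>V. g v \<in> {-1, 1, 2}" and h: "h \<in> {-1, 1, 2}"
    using F by (auto simp: g_def)
  have maj: "n \<le> 2 * ((if h + sum g V \<ge> 1 then 1 else 0)
      + card {v \<in> V. h + sum g (closed_nbhd H v) \<ge> 1})"
    using F n by (simp add: g_eq V_def)
  note total = sum_by_values[OF fin vals]
  \<comment> \<open>\<open>(n + 5) div 6\<close> is the ceiling of n/6. This bound settles every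
    function of positive weight, so afterwards the hub is unsatisfied and the majority lies in the
    rim.\<close>
  have bound: "2 * int ((n + 5) div 6) - int n + 3 \<le> 1"
  proof -
    have "2 * ((n + 5) div 6) + 2 \<le> n"
      using n(2) by presburger
    then show ?thesis by linarith
  qed
  show ?thesis
  proof (cases "h + sum g V \<ge> 1")
    case True
    then show ?thesis using bound weight by simp
  next
    case neg: False
    show ?thesis
    proof (cases "h = 2")
      case True
      have "{v \<in> V. g v > 0} = {v \<in> V. g v = 2} \<union> {v \<in> V. g v = 1}"
        using vals by auto
      then have P: "card {v \<in> V. g v > 0} = card {v \<in> V. g v = 2} + card {v \<in> V. g v = 1}"
        using fin by (simp add: card_Un_disjoint disjoint_iff)
      have "n \<le> 6 * card {v \<in> V. g v > 0}"
        using maj neg True dominated_count[OF H deg vals[unfolded V_def]] by (simp add: V_def)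
      then have "(n + 5) div 6 \<le> card {v \<in> V. g v > 0}"
        by linarith
      \<comment> \<open>With p positive rim vertices the weight is at least 2 + p - (n - 1 - p) = 2p
        - n + 3.\<close>
      then show ?thesis
        using weight True total P n(1)[folded V_def] by linarith
    next
      case False
      have deg3: "\<forall>v\<in>verts H. card (closed_nbhd H v) \<le> 3"
        using deg by auto
      have roman: "\<forall>u\<in>verts H. g u = -1 \<longrightarrow> (\<exists>w\<in>verts H. {u, w} \<in> edges H \<and> g w = 2)"
        using F False by (auto simp: V_def g_def)
      note R = roman_weight_nonneg[OF H deg3 vals[unfolded V_def] roman, folded V_def]
      \<comment> \<open>Hub value 1 and a nonnegative rim would give positive weight.\<close>
      have "h = -1"
        using h False neg total R(1) by auto
      have "{v \<in> V. h + sum g (closed_nbhd H v) \<ge> 1} \<noteq> {}"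
      proof
        assume "{v \<in> V. h + sum g (closed_nbhd H v) \<ge> 1} = {}"
        then show False using maj neg n(2) by (simp only: card.empty) simp
      qed
      then obtain v where "v \<in> V" "sum g (closed_nbhd H v) \<ge> 2"
        using \<open>h = -1\<close> by auto
      then have one: "sum g V = 1"
        using R(2) neg \<open>h = -1\<close> by fastforce
      \<comment> \<open>The total weight is now 0, which is below the claimed value only for n = 4.
        There the rim has three vertices, and \<open>a\<close>, \<open>b\<close>, \<open>c\<close>
        count its values 2, -1, 1.\<close>
      have "a + b + c \<noteq> 3" if "1 = 2 * int a + int c - int b" "b \<le> 2 * a" for a b c
        using that by presburger
      from this[OF total(1)[unfolded one] R(1)] have "n \<noteq> 4"
        using total(2) n(1) by (simp add: V_def)
      then have "2 * ((n + 5) div 6) + 3 \<le> n"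
        using n(2) by presburger
      then show ?thesis
        using one weight \<open>h = -1\<close> by simp
    qed
  qed
qed

section \<open>Upper bound\<close>

lemma gamma_MR_cone:
  assumes H: "simple_graph H" and V: "verts H = {..<n - 1}" and n: "n \<ge> 4"
    and path: "\<forall>i. Suc i < n - 1 \<longrightarrow> {i, Suc i} \<in> edges H"
    and deg: "\<forall>v\<in>verts H. card (closed_nbhd H v) \<le> 3"
  shows "gamma_MR (cone H) = 2 * int ((n + 5) div 6) - int n + 3"
proof -
  have adjacent: "{i, Suc i} \<in> edges H" "{Suc i, i} \<in> edges H" if "Suc i < n - 1" for i
    using path that insert_commute[of "Suc i" i "{}"] by auto
  show ?thesis
  proof (rule antisym)
    define k where "k = (n + 5) div 6"
    \<comment> \<open>Cut the first \<open>3 * k\<close> path vertices into consecutive triples and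
      put 1 at each middle vertex.\<close>
    define g :: "nat \<Rightarrow> int" where "g = (\<lambda>i. if i mod 3 = 1 \<and> i < 3 * k then 1 else -1)"
    define f :: "nat + nat \<Rightarrow> int" where "f = case_sum (\<lambda>_. 2) g"
    \<comment> \<open>The triples fit into the path, and their \<open>3 * k\<close> vertices are at
      least half of all \<open>n\<close>.\<close>
    have k: "3 * k \<le> n - 1" "n \<le> 6 * k"
      using n unfolding k_def by presburger+
    have good: "2 + sum g (closed_nbhd H v) \<ge> 1" if "v < 3 * k" for v
    proof -
      \<comment> \<open>The middle of the triple containing \<open>v\<close>.\<close>
      define c where "c = 3 * (v div 3) + 1"
      have c: "c < 3 * k"
      proof -
        have "v div 3 < k"
          using that by (simp add: div_less_iff_less_mult mult.commute)
        then show ?thesis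
          unfolding c_def by linarith
      qed
      have near: "c = v \<or> c = Suc v \<or> v = Suc c"
        unfolding c_def by presburger
      from c have gc: "g c = 1"
        by (simp add: g_def c_def)
      have mem: "c \<in> closed_nbhd H v"
        using c near k that adjacent[of v] adjacent[of c] by (auto simp: closed_nbhd_def)
      have fin: "finite (closed_nbhd H v)"
        by (rule finite_closed_nbhd[OF H])
      have le: "card (closed_nbhd H v) \<le> 3"
        using deg V that k by auto
      have "sum g (closed_nbhd H v - {c}) \<ge> - int (card (closed_nbhd H v - {c}))"
        using sum_bounded_below[of "closed_nbhd H v - {c}" "-1" g] by (simp add: g_def)
      moreover have "card (closed_nbhd H v - {c}) \<le> 2"
        using mem fin le by simp
      \<comment> \<open>Even in the worst case the sum is 2 + 1 - 2 = 1.\<close>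
      ultimately show ?thesis
        using sum.remove[OF fin mem, of g] gc by simp
    qed
    have "{..<3 * k} \<subseteq> {v \<in> verts H. 2 + sum g (closed_nbhd H v) \<ge> 1}"
      using good k V by auto
    then have "3 * k \<le> card {v \<in> verts H. 2 + sum g (closed_nbhd H v) \<ge> 1}"
      using card_mono[of "{v \<in> verts H. 2 + sum g (closed_nbhd H v) \<ge> 1}" "{..<3 * k}"] V by simp
    then have "MRDF (cone H) f"
      unfolding MRDF_cone_iff[OF H] using k n V by (auto simp: f_def g_def)
    then have "gamma_MR (cone H) \<le> sum f (verts (cone H))"
      by (intro gamma_MR_le simple_cone H)
    also have "sum f (verts (cone H)) = 2 + (\<Sum>v<n - 1. g v)"
      by (simp add: verts_cone V sum_insert_Inl f_def)
    also have "(\<Sum>v<n - 1. g v) = (\<Sum>v<3 * k. g v) + (\<Sum>v=3 * k..<n - 1. g v)"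
      using k(1) by (metis sum.atLeastLessThan_concat atLeast0LessThan le0)
    also have "(\<Sum>v=3 * k..<n - 1. g v) = (\<Sum>v=3 * k..<n - 1. -1)"
      by (intro sum.cong) (auto simp: g_def)
    also have "(\<Sum>v<3 * k. g v) = (\<Sum>v<3 * k. if v mod 3 = 1 then 1 else -1)"
      by (intro sum.cong) (auto simp: g_def)
    \<comment> \<open>Each triple contributes -1 + 1 - 1 = -1. The total weight is then 2 - k - (n -
      1 - 3k) = 2k - n + 3.\<close>
    also have "\<dots> = - int k"
    proof (induction k)
      case (Suc k)
      have "3 * Suc k = Suc (Suc (Suc (3 * k)))" by simp
      moreover have "Suc (3 * k) mod 3 = 1" "Suc (Suc (3 * k)) mod 3 = 2" "(3 * k) mod 3 = 0"
        by presburger+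
      ultimately show ?case using Suc by (simp only: sum.lessThan_Suc) simp
    qed simp
    finally show "gamma_MR (cone H) \<le> 2 * int ((n + 5) div 6) - int n + 3"
      using k n by (simp add: k_def[symmetric] of_nat_diff)
  next
    have "card (closed_nbhd H v) \<in> {2, 3}" if v: "v \<in> verts H" for v
    proof -
      \<comment> \<open>A neighbour of \<open>v\<close> along the path; it rules out isolated
        vertices, as the lower bound requires.\<close>
      define w where "w = (if v = 0 then 1 else v - 1)"
      have "{w, v} \<in> edges H"
      proof (cases v)
        case 0
        then show ?thesis
          using n adjacent(2)[of 0] by (simp add: w_def)
      next
        case (Suc j)
        then show ?thesis
          using v V adjacent(1)[of j] by (simp add: w_def)
      qed
      then have "{v, w} \<subseteq> closed_nbhd H v"
        by (simp add: closed_nbhd_def)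
      then have "card {v, w} \<le> card (closed_nbhd H v)"
        by (intro card_mono finite_closed_nbhd[OF H])
      moreover have "card {v, w} = 2"
        by (auto simp: w_def)
      moreover have "card (closed_nbhd H v) \<le> 3"
        using deg v by blast
      ultimately show ?thesis
        by (simp only: insert_iff empty_iff) linarith
    qed
    then have "\<forall>v\<in>verts H. card (closed_nbhd H v) \<in> {2, 3}" ..
    moreover obtain f where "MRDF (cone H) f" "sum f (verts (cone H)) = gamma_MR (cone H)"
      using gamma_MR_attained[OF simple_cone[OF H]] by blast
    ultimately show "2 * int ((n + 5) div 6) - int n + 3 \<le> gamma_MR (cone H)"
      using MRDF_cone_weight_ge[OF H, of n f] V n by simp
  qed
qed

section \<open>Fans and wheels\<close>

lemma card_closed_nbhd_path_graph: "card (closed_nbhd (path_graph m) v) \<le> 3"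
proof -
  \<comment> \<open>A list bounds the cardinality even when entries coincide; at
    \<open>v = 0\<close> the truncated \<open>v - 1\<close> is \<open>v\<close> itself.\<close>
  have "closed_nbhd (path_graph m) v \<subseteq> set [v, Suc v, v - 1]"
    by (auto simp: closed_nbhd_def path_graph_def doubleton_eq_iff)
  from card_mono[OF _ this] card_length[of "[v, Suc v, v - 1]"] show ?thesis
    by simp
qed

lemma card_closed_nbhd_cycle_graph: "card (closed_nbhd (cycle_graph m) v) \<le> 3"
proof -
  \<comment> \<open>Inverts the cyclic successor, so that \<open>v\<close> has only one possible
    predecessor.\<close>
  have pred: "i = (if v = 0 then m - 1 else v - 1)" if "i < m" "v = Suc i mod m" for i
    using that by (cases "Suc i = m") auto
  have "closed_nbhd (cycle_graph m) v \<subseteq> set [v, Suc v mod m, if v = 0 then m - 1 else v - 1]"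
  proof
    fix u assume "u \<in> closed_nbhd (cycle_graph m) v"
    then have "u = v \<or> (\<exists>i<m. {u, v} = {i, Suc i mod m})"
      by (auto simp: closed_nbhd_def cycle_graph_def)
    then consider "u = v" | "u = Suc v mod m" | "u < m" "v = Suc u mod m"
      by (metis doubleton_eq_iff)
    then show "u \<in> set [v, Suc v mod m, if v = 0 then m - 1 else v - 1]"
    proof cases
      case 3
      from pred[OF this] show ?thesis by (simp only: list.set insert_iff simp_thms)
    qed simp_all
  qed
  from card_mono[OF _ this]
    card_length[of "[v, Suc v mod m, if v = 0 then m - 1 else v - 1]"] show ?thesis
    by simp
qed

text \<open>Both sides equal the closed form of \<open>gamma_MR_cone\<close>; the known wheel
  formula is thereby reproved rather than assumed.\<close>

theorem proposition6:
  fixes n :: nat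
  assumes "n \<ge> 4"
  shows "gamma_MR (fan_graph n) = gamma_MR (wheel_graph n)"
proof -
  have "gamma_MR (cone (path_graph (n - 1))) = 2 * int ((n + 5) div 6) - int n + 3"
  proof (rule gamma_MR_cone[OF simple_path_graph _ assms])
    show "\<forall>i. Suc i < n - 1 \<longrightarrow> {i, Suc i} \<in> edges (path_graph (n - 1))"
      by (auto simp: path_graph_def)
  next
    show "verts (path_graph (n - 1)) = {..<n - 1}"
      by (simp add: path_graph_def)
  next
    show "\<forall>v\<in>verts (path_graph (n - 1)). card (closed_nbhd (path_graph (n - 1)) v) \<le> 3"
      using card_closed_nbhd_path_graph by blast
  qed
  moreover have "gamma_MR (cone (cycle_graph (n - 1))) = 2 * int ((n + 5) div 6) - int n + 3"
  proof (rule gamma_MR_cone[OF simple_cycle_graph _ assms])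
    have "{i, Suc i} \<in> edges (cycle_graph (n - 1))" if "Suc i < n - 1" for i
    proof -
      \<comment> \<open>Before the wrap-around, cycle edges are path edges.\<close>
      have "{i, Suc i} = {i, Suc i mod (n - 1)} \<and> i < n - 1"
        using that by simp
      then show ?thesis
        unfolding cycle_graph_def graph.simps by blast
    qed
    then show "\<forall>i. Suc i < n - 1 \<longrightarrow> {i, Suc i} \<in> edges (cycle_graph (n - 1))"
      by blast
  next
    show "n - 1 \<ge> 3"
      using assms by simp
  next
    show "verts (cycle_graph (n - 1)) = {..<n - 1}"
      by (simp add: cycle_graph_def)
  next
    show "\<forall>v\<in>verts (cycle_graph (n - 1)). card (closed_nbhd (cycle_graph (n - 1)) v) \<le> 3"
      using card_closed_nbhd_cycle_graph by blast
  qed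
  ultimately show ?thesis
    by (simp only: fan_graph_def wheel_graph_def cone_def)
qed

end
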